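(* Let $q$ be a prime power, let $\mathbf{k}=\mathbb{F}_q$, let $U,V,W$ be finite-dimensional vector spaces over $\mathbf{k}$, and let $f:U\times V\times W\to\mathbf{k}$ be a trilinear form. Then $$\mathrm{srk}(f)\le 5\cdot \mathrm{ark}(f)+4\cdot\log_q(\mathrm{ark}(f)+1)+29.$$ In addition, the linear forms in the corresponding slice rank decomposition are obtained from $f$ by fixing coordinates; that is, there is a decomposition $f=\sum_{i=1}^{m}\alpha_i\cdot h_i$ with $m\le 5\cdot \mathrm{ark}(f)+4\cdot\log_q(\mathrm{ark}(f)+1)+29$, where for each $i$ the forms $\alpha_i$ (linear) and $h_i$ (bilinear) are in disjoint sets of variables and $\alpha_i$ is obtained from $f$ by fixing coordinates.
   Context: For a trilinear form $f:U\times V\times W\to\mathbf{k}$ over $\mathbf{k}=\mathbb{F}_q$: The slice rank of $f$ is $\mathrm{srk}(f)=\min\{m: f=\sum_{i=1}^m \alpha_i\cdot h_i\}$, where for each $i$ the functions $\alpha_i$ and $h_i$ are linear and bilinear, respectively, in disjoint sets of variables. That is, for each $i$, either $\alpha_i$ is a linear form on $U$ and $h_i$ is a bilinear form on $V\times W$, or $\alpha_i$ is a linear form on $V$ and $h_i$ is a bilinear form on $U\times W$, or $\alpha_i$ is a linear form on $W$ and $h_i$ is a bilinear form on $U\times V$. (The empty sum is $0$, so $\mathrm{srk}(0)=0$.) The analytic rank of $f$ is the real number $\mathrm{ark}(f)=-\log_q\frac{|Z|}{|U\times V|}$, where $Z=\{(u,v)\in U\times V: f(u,v,w)=0 \text{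 for all } w\in W\}$. A linear form is obtained from $f$ by fixing coordinates if it arises from $f$ by fixing two of its three arguments: a linear form on $U$ of the shape $u\mapsto f(u,v_0,w_0)$ for some $v_0\in V,w_0\in W$, a linear form on $V$ of the shape $v\mapsto f(u_0,v,w_0)$ for some $u_0\in U,w_0\in W$, or a linear form on $W$ of the shape $w\mapsto f(u_0,v_0,w)$ for some $u_0\in U,v_0\in V$. *)

theory Defs
  imports Complex_Main "HOL-Library.Cardinality"
begin

text \<open>
  Vector spaces over the finite field \<open>'k\<close> are types \<open>'u\<close>, \<open>'v\<close>, \<open>'w\<close> with explicit scalar
  multiplications \<open>sU\<close>, \<open>sV\<close>, \<open>sW\<close>, as in \<open>HOL.Vector_Spaces\<close>; the field is a vector space over
  itself through \<open>(*)\<close>. Multilinear forms are curried.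
\<close>

definition linear_form ::
    "('k::field \<Rightarrow> 'u::ab_group_add \<Rightarrow> 'u) \<Rightarrow> ('u \<Rightarrow> 'k) \<Rightarrow> bool" where
  "linear_form sU \<alpha> \<longleftrightarrow> Vector_Spaces.linear sU (*) \<alpha>"

definition bilinear_form ::
    "('k::field \<Rightarrow> 'u::ab_group_add \<Rightarrow> 'u) \<Rightarrow> ('k \<Rightarrow> 'v::ab_group_add \<Rightarrow> 'v)
      \<Rightarrow> ('u \<Rightarrow> 'v \<Rightarrow> 'k) \<Rightarrow> bool" where
  "bilinear_form sU sV h \<longleftrightarrow>
     (\<forall>v. linear_form sU (\<lambda>u. h u v)) \<and> (\<forall>u. linear_form sV (\<lambda>v. h u v))"

definition trilinear_form ::
    "('k::field \<Rightarrow> 'u::ab_group_add \<Rightarrow> 'u) \<Rightarrow> ('k \<Rightarrow> 'v::ab_group_add \<Rightarrow> 'v)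
      \<Rightarrow> ('k \<Rightarrow> 'w::ab_group_add \<Rightarrow> 'w) \<Rightarrow> ('u \<Rightarrow> 'v \<Rightarrow> 'w \<Rightarrow> 'k) \<Rightarrow> bool" where
  "trilinear_form sU sV sW f \<longleftrightarrow>
     (\<forall>v w. linear_form sU (\<lambda>u. f u v w)) \<and>
     (\<forall>u w. linear_form sV (\<lambda>v. f u v w)) \<and>
     (\<forall>u v. linear_form sW (\<lambda>w. f u v w))"

text \<open>
  The products \<open>\<alpha> \<cdot> h\<close> of a linear and a bilinear form in disjoint sets of variables. The sets
  \<open>A\<close>, \<open>B\<close>, \<open>C\<close> restrict the linear factor \<open>\<alpha>\<close> when it is a form on \<open>U\<close>, \<open>V\<close>, \<open>W\<close> respectively.
\<close>

definition slices ::
    "('k::field \<Rightarrow> 'u::ab_group_add \<Rightarrow> 'u) \<Rightarrow> ('k \<Rightarrow> 'v::ab_group_add \<Rightarrow> 'v)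
      \<Rightarrow> ('k \<Rightarrow> 'w::ab_group_add \<Rightarrow> 'w)
      \<Rightarrow> ('u \<Rightarrow> 'k) set \<Rightarrow> ('v \<Rightarrow> 'k) set \<Rightarrow> ('w \<Rightarrow> 'k) set \<Rightarrow> ('u \<Rightarrow> 'v \<Rightarrow> 'w \<Rightarrow> 'k) set" where
  "slices sU sV sW A B C =
     {\<lambda>u v w. \<alpha> u * h v w | \<alpha> h. \<alpha> \<in> A \<and> linear_form sU \<alpha> \<and> bilinear_form sV sW h} \<union>
     {\<lambda>u v w. \<alpha> v * h u w | \<alpha> h. \<alpha> \<in> B \<and> linear_form sV \<alpha> \<and> bilinear_form sU sW h} \<union>
     {\<lambda>u v w. \<alpha> w * h u v | \<alpha> h. \<alpha> \<in> C \<and> linear_form sW \<alpha> \<and> bilinear_form sU sV h}"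

definition sum_of ::
    "nat \<Rightarrow> ('u \<Rightarrow> 'v \<Rightarrow> 'w \<Rightarrow> 'k::field) set \<Rightarrow> ('u \<Rightarrow> 'v \<Rightarrow> 'w \<Rightarrow> 'k) \<Rightarrow> bool" where
  "sum_of m S f \<longleftrightarrow>
     (\<exists>g. (\<forall>i<m. g i \<in> S) \<and> (\<forall>u v w. f u v w = (\<Sum>i<m. g i u v w)))"

text \<open>
  For a trilinear form on finite-dimensional spaces the set of admissible \<open>m\<close> is nonempty (expand
  along a basis of \<open>U\<close>), so the least one exists.
\<close>

definition slice_rank ::
    "('k::field \<Rightarrow> 'u::ab_group_add \<Rightarrow> 'u) \<Rightarrow> ('k \<Rightarrow> 'v::ab_group_add \<Rightarrow> 'v)
      \<Rightarrow> ('k \<Rightarrow> 'w::ab_group_add \<Rightarrow> 'w) \<Rightarrow> ('u \<Rightarrow> 'v \<Rightarrow> 'w \<Rightarrow> 'k) \<Rightarrow> nat" where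
  "slice_rank sU sV sW f = (LEAST m. sum_of m (slices sU sV sW UNIV UNIV UNIV) f)"

text \<open>
  Finite-dimensional spaces over a finite field are finite, so the cardinalities here are genuine.
\<close>

definition analytic_rank :: "('u \<Rightarrow> 'v \<Rightarrow> 'w \<Rightarrow> 'k::{field,finite}) \<Rightarrow> real" where
  "analytic_rank f =
     - log (real CARD('k)) (real (card {(u, v). \<forall>w. f u v w = 0}) / real CARD('u \<times> 'v))"

definition fixed_coordinate_slices ::
    "('k::field \<Rightarrow> 'u::ab_group_add \<Rightarrow> 'u) \<Rightarrow> ('k \<Rightarrow> 'v::ab_group_add \<Rightarrow> 'v)
      \<Rightarrow> ('k \<Rightarrow> 'w::ab_group_add \<Rightarrow> 'w) \<Rightarrow> ('u \<Rightarrow> 'v \<Rightarrow> 'w \<Rightarrow> 'k)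
      \<Rightarrow> ('u \<Rightarrow> 'v \<Rightarrow> 'w \<Rightarrow> 'k) set" where
  "fixed_coordinate_slices sU sV sW f =
     slices sU sV sW
       {\<lambda>u. f u v0 w0 | v0 w0. True}
       {\<lambda>v. f u0 v w0 | u0 w0. True}
       {\<lambda>w. f u0 v0 w | u0 v0. True}"

end

theory Submission
  imports Defs "HOL-Analysis.Convex"
begin

text \<open>
  Write \<open>q\<close> for the order of the field. For subspaces \<open>V0\<close>, \<open>W0\<close> of \<open>V\<close>, \<open>W\<close> let \<open>r(u)\<close> be the
  rank of the bilinear form \<open>f u\<close> restricted to \<open>V0 \<times> W0\<close>, let \<open>M(s)\<close> be the average of
  \<open>q powr (- s r(u))\<close> over \<open>u\<close>, and let \<open>m(s) = - log q M(s)\<close>. With \<open>V0 = V\<close> and \<open>W0 = W\<close>, the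
  analytic rank is \<open>m(1)\<close>; as \<open>s\<close> grows, \<open>m(s)\<close> tends to the codimension of the space of those \<open>u\<close>
  for which \<open>f u\<close> vanishes on \<open>V0 \<times> W0\<close>.

  The idea is to replace \<open>V0\<close>, \<open>W0\<close> by the left and right kernels \<open>V1\<close>, \<open>W1\<close> of \<open>f u0\<close> on
  \<open>V0 \<times> W0\<close>, for a well chosen \<open>u0\<close>. This costs \<open>r(u0)\<close> linear forms on each of \<open>V\<close> and \<open>W\<close>, all
  obtained from \<open>f\<close> by fixing coordinates. If \<open>r'(u)\<close> is the rank of \<open>f u\<close> on \<open>V1 \<times> W1\<close>, then
  \<open>r(u0) + 2 r'(u) \<le> r(u) + r(u0 - u)\<close> (lemma \<open>dens_restrict\<close>). So the new \<open>M'(2 s)\<close> is at least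
  \<open>q powr (s r(u0))\<close> times the autocorrelation at \<open>u0\<close> of the function \<open>q powr (- s r)\<close>, whose
  average over \<open>u0\<close> is \<open>M(s)\<^sup>2\<close>. Choosing \<open>u0\<close> by averaging (lemma
  \<open>exists_large_autocorrelation\<close>) gives
  \<open>2 r(u0) + (1 + 4 / (2 s)) m'(2 s) \<le> (1 + 4 / s) m(s)\<close>,
  which is lemma \<open>potential_step\<close>. Starting from \<open>s = 1\<close>, where the right side is \<open>5\<close> times the
  analytic rank, and doubling \<open>s\<close> repeatedly, one reaches subspaces \<open>V0\<close>, \<open>W0\<close> for which the sum
  of their codimensions and of the codimension of \<open>{u. f u = 0 on V0 \<times> W0}\<close> is at most \<open>5\<close> times
  the analytic rank, plus \<open>1\<close> (lemma \<open>fixed_coordinate_decomposition\<close>). A trilinear form that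
  vanishes on a product of three subspaces is a sum of as many slices as the sum of their
  codimensions, with linear factors the equations of the subspaces (lemma \<open>slices_of_vanishing\<close>).
\<close>

section \<open>Finite vector spaces and subspaces cut out by linear forms\<close>

text \<open>A finite vector space over a finite field; its points are all elements of the type.\<close>

locale finite_space = vector_space scale
  for scale :: "'k::{field,finite} \<Rightarrow> 'a::ab_group_add \<Rightarrow> 'a" +
  assumes finite_UNIV: "finite (UNIV :: 'a set)"
begin

lemma finite_set [simp]: "finite (S :: 'a set)"
  using finite_UNIV by (rule rev_finite_subset) simp

lemma linear_form_iff:
  "linear_form scale \<alpha> \<longleftrightarrow>
     (\<forall>x y. \<alpha> (x + y) = \<alpha> x + \<alpha> y) \<and> (\<forall>c x. \<alpha> (scale c x) = c * \<alpha> x)"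
proof -
  have "vector_space ((*) :: 'k \<Rightarrow> 'k \<Rightarrow> 'k)"
    by unfold_locales (auto simp: algebra_simps)
  with vector_space_axioms show ?thesis
    by (simp add: linear_form_def Vector_Spaces.linear_iff)
qed

lemma linear_form_add: "linear_form scale \<alpha> \<Longrightarrow> \<alpha> (x + y) = \<alpha> x + \<alpha> y"
  and linear_form_scale: "linear_form scale \<alpha> \<Longrightarrow> \<alpha> (scale c x) = c * \<alpha> x"
  by (auto simp: linear_form_iff)

lemma linear_form_zero: "linear_form scale \<alpha> \<Longrightarrow> \<alpha> 0 = 0"
  using linear_form_scale[of \<alpha> 0 0] by simp

lemma linear_form_diff: "linear_form scale \<alpha> \<Longrightarrow> \<alpha> (x - y) = \<alpha> x - \<alpha> y"
  using linear_form_add[of \<alpha> "x - y" y] by simp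

lemma linear_form_sum:
  "linear_form scale \<alpha> \<Longrightarrow> \<alpha> (\<Sum>i\<in>I. scale (c i) (x i)) = (\<Sum>i\<in>I. c i * \<alpha> (x i))"
  by (induction I rule: infinite_finite_induct)
     (simp_all add: linear_form_zero linear_form_add linear_form_scale)

lemma subspace_zeros:
  assumes "subspace T" "\<And>\<alpha>. \<alpha> \<in> B \<Longrightarrow> linear_form scale \<alpha>"
  shows "subspace {x \<in> T. \<forall>\<alpha>\<in>B. \<alpha> x = 0}"
  using assms
  by (auto intro!: subspaceI simp: subspace_0 subspace_add subspace_scale
        linear_form_zero linear_form_add linear_form_scale)

lemma card_subspace_pos: "subspace T \<Longrightarrow> card T > 0"
  using subspace_0[of T] by (auto simp: card_gt_0_iff)

text \<open>The inequality \<open>dim X + dim Y \<le> dim Z + dim (X \<inter> Y)\<close>, in terms of cardinalities.\<close>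

lemma card_subspaces_mult_le:
  assumes X: "subspace X" "X \<subseteq> Z" and Y: "subspace Y" "Y \<subseteq> Z" and Z: "subspace Z"
  shows "card X * card Y \<le> card Z * card (X \<inter> Y)"
proof -
  \<comment> \<open>\<open>g z\<close> is a fixed way of writing \<open>z\<close> as a sum; any other differs from it by a point of \<open>X \<inter> Y\<close>.\<close>
  define g where "g z = (SOME p. p \<in> X \<times> Y \<and> fst p + snd p = z)" for z
  have g: "g (x + y) \<in> X \<times> Y \<and> fst (g (x + y)) + snd (g (x + y)) = x + y"
    if "x \<in> X" "y \<in> Y" for x y
    unfolding g_def by (rule someI[of _ "(x, y)"]) (use that in auto)
  have "inj_on (\<lambda>(x, y). (x + y, x - fst (g (x + y)))) (X \<times> Y)"
    by (auto simp: inj_on_def)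
  moreover have "(\<lambda>(x, y). (x + y, x - fst (g (x + y)))) ` (X \<times> Y) \<subseteq> Z \<times> (X \<inter> Y)"
  proof clarsimp
    fix x y assume xy: "x \<in> X" "y \<in> Y"
    have gX: "fst (g (x + y)) \<in> X" and gY: "snd (g (x + y)) \<in> Y"
      using g[OF xy] by (auto simp: mem_Times_iff)
    have eq: "x - fst (g (x + y)) = snd (g (x + y)) - y"
      using g[OF xy] by (simp add: algebra_simps)
    have "x + y \<in> Z" using xy X Y Z by (auto intro: subspace_add)
    moreover have "x - fst (g (x + y)) \<in> X" using xy gX X by (auto intro: subspace_diff)
    moreover have "x - fst (g (x + y)) \<in> Y"
      unfolding eq using xy gY Y by (auto intro: subspace_diff)
    ultimately show "x + y \<in> Z \<and> x - fst (g (x + y)) \<in> X \<and> x - fst (g (x + y)) \<in> Y"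
      by blast
  qed
  ultimately have "card (X \<times> Y) \<le> card (Z \<times> (X \<inter> Y))"
    by (intro card_inj_on_le) auto
  then show ?thesis by (simp add: card_cartesian_product)
qed

lemma card_kernel:
  assumes T: "subspace T" and \<alpha>: "linear_form scale \<alpha>" and e: "e \<in> T" "\<alpha> e \<noteq> 0"
  shows "card T = CARD('k) * card {x \<in> T. \<alpha> x = 0}"
proof -
  let ?K = "{x \<in> T. \<alpha> x = 0}"
  define d where "d = scale (inverse (\<alpha> e)) e"
  have d: "d \<in> T" "\<alpha> d = 1"
    using e T by (auto simp: d_def linear_form_scale[OF \<alpha>] intro: subspace_scale)
  have "bij_betw (\<lambda>(c, x). x + scale c d) (UNIV \<times> ?K) T"
    by (rule bij_betw_byWitness[where f' = "\<lambda>x. (\<alpha> x, x - scale (\<alpha> x) d)"])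
       (use d T in \<open>auto simp: linear_form_add[OF \<alpha>] linear_form_diff[OF \<alpha>]
          linear_form_scale[OF \<alpha>] intro: subspace_add subspace_diff subspace_scale\<close>)
  then have "card (UNIV \<times> ?K :: ('k \<times> 'a) set) = card T"
    by (rule bij_betw_same_card)
  then show ?thesis by (simp add: card_cartesian_product)
qed

lemma card_kernel_cases:
  assumes T: "subspace T" and \<alpha>: "linear_form scale \<alpha>"
  shows "CARD('k) * card {x \<in> T. \<alpha> x = 0}
           = card T + (if \<forall>x\<in>T. \<alpha> x = 0 then (CARD('k) - 1) * card T else 0)"
proof (cases "\<forall>x\<in>T. \<alpha> x = 0")
  case True
  then have "{x \<in> T. \<alpha> x = 0} = T" by auto
  moreover obtain r where "CARD('k) = Suc r"
    using not0_implies_Suc[of "CARD('k)"] by auto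
  ultimately show ?thesis using True by simp
next
  case False
  then obtain e where "e \<in> T" "\<alpha> e \<noteq> 0" by auto
  with card_kernel[OF T \<alpha>] False show ?thesis by auto
qed

text \<open>
  \<open>cuts A n T\<close>: the subspace \<open>T\<close> has codimension \<open>n\<close> and is the set of common zeros of \<open>n\<close> linear
  forms from \<open>A\<close>, none of which vanishes identically on the common zeros of those before it.
\<close>

inductive cuts :: "('a \<Rightarrow> 'k) set \<Rightarrow> nat \<Rightarrow> 'a set \<Rightarrow> bool" for A where
  cuts_UNIV: "cuts A 0 UNIV"
| cuts_Suc: "cuts A n T \<Longrightarrow> \<alpha> \<in> A \<Longrightarrow> linear_form scale \<alpha> \<Longrightarrow> e \<in> T \<Longrightarrow> \<alpha> e \<noteq> 0
     \<Longrightarrow> cuts A (Suc n) {x \<in> T. \<alpha> x = 0}"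

lemma cuts_subspace: "cuts A n T \<Longrightarrow> subspace T"
proof (induction rule: cuts.induct)
  case (cuts_Suc n T \<alpha> e)
  then show ?case using subspace_zeros[of T "{\<alpha>}"] by simp
qed simp

lemma cuts_card: "cuts A n T \<Longrightarrow> card T * CARD('k) ^ n = CARD('a)"
proof (induction rule: cuts.induct)
  case (cuts_Suc n T \<alpha> e)
  then show ?case using card_kernel[OF cuts_subspace, of A n T \<alpha> e] by (simp add: mult_ac)
qed simp

lemma cuts_zeros:
  assumes "cuts A n T" "B \<subseteq> A" "\<And>\<alpha>. \<alpha> \<in> B \<Longrightarrow> linear_form scale \<alpha>"
  shows "\<exists>m. cuts A (n + m) {x \<in> T. \<forall>\<alpha>\<in>B. \<alpha> x = 0}"
  using assms(1)
proof (induction "card T" arbitrary: n T rule: less_induct)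
  case less
  show ?case
  proof (cases "\<forall>\<alpha>\<in>B. \<forall>x\<in>T. \<alpha> x = 0")
    case True
    then have "{x \<in> T. \<forall>\<alpha>\<in>B. \<alpha> x = 0} = T" by auto
    with less.prems show ?thesis by (metis add_0_right)
  next
    case False
    then obtain \<alpha> e where \<alpha>: "\<alpha> \<in> B" "e \<in> T" "\<alpha> e \<noteq> 0" by blast
    let ?T = "{x \<in> T. \<alpha> x = 0}"
    have "cuts A (Suc n) ?T"
      using less.prems \<alpha> assms by (intro cuts_Suc) auto
    moreover have "?T \<subset> T" using \<alpha> by auto
    then have "card ?T < card T" by (intro psubset_card_mono) auto
    ultimately obtain m where "cuts A (Suc n + m) {x \<in> ?T. \<forall>\<alpha>\<in>B. \<alpha> x = 0}"
      using less.hyps by blast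
    moreover have "{x \<in> ?T. \<forall>\<alpha>\<in>B. \<alpha> x = 0} = {x \<in> T. \<forall>\<alpha>\<in>B. \<alpha> x = 0}"
      using \<alpha>(1) by auto
    ultimately show ?thesis by (metis add_Suc_shift)
  qed
qed

text \<open>A projection onto \<open>T\<close> differs from the identity by \<open>n\<close> terms led by forms from \<open>A\<close>.\<close>

lemma cuts_projection:
  assumes "cuts A n T"
  shows "\<exists>a e. (\<forall>i<n. a i \<in> A \<and> linear_form scale (a i)) \<and>
               (\<forall>x. x - (\<Sum>i<n. scale (a i x) (e i)) \<in> T)"
  using assms
proof (induction rule: cuts.induct)
  case (cuts_Suc n T \<alpha> e)
  note T = cuts_subspace[OF cuts_Suc.hyps(1)] and \<alpha> = cuts_Suc.hyps(3)
  obtain a es where a: "\<And>i. i < n \<Longrightarrow> a i \<in> A \<and> linear_form scale (a i)"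
    and es: "\<And>x. x - (\<Sum>i<n. scale (a i x) (es i)) \<in> T"
    using cuts_Suc.IH by auto
  define d where "d = scale (inverse (\<alpha> e)) e"
  have d: "d \<in> T" "\<alpha> d = 1"
    using cuts_Suc.hyps T by (auto simp: d_def linear_form_scale[OF \<alpha>] intro: subspace_scale)
  define a' where "a' = a(n := \<alpha>)"
  define e' where "e' i = (if i < n then es i - scale (\<alpha> (es i)) d else d)" for i
  have "x - (\<Sum>i<Suc n. scale (a' i x) (e' i)) \<in> {x \<in> T. \<alpha> x = 0}" for x
  proof -
    define y where "y = x - (\<Sum>i<n. scale (a i x) (es i))"
    have y: "y \<in> T" using es by (simp add: y_def)
    have \<alpha>y: "\<alpha> y = \<alpha> x - (\<Sum>i<n. a i x * \<alpha> (es i))"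
      by (simp add: y_def linear_form_diff[OF \<alpha>] linear_form_sum[OF \<alpha>])
    have "(\<Sum>i<Suc n. scale (a' i x) (e' i))
            = (\<Sum>i<n. scale (a i x) (es i - scale (\<alpha> (es i)) d)) + scale (\<alpha> x) d"
      by (simp add: a'_def e'_def)
    also have "\<dots> = (\<Sum>i<n. scale (a i x) (es i)) + scale (\<alpha> y) d"
      by (simp add: \<alpha>y scale_right_diff_distrib scale_left_diff_distrib sum_subtractf
            scale_sum_left)
    finally have "x - (\<Sum>i<Suc n. scale (a' i x) (e' i)) = y - scale (\<alpha> y) d"
      by (simp add: y_def algebra_simps)
    moreover have "y - scale (\<alpha> y) d \<in> {x \<in> T. \<alpha> x = 0}"
      using y d T by (auto simp: linear_form_diff[OF \<alpha>] linear_form_scale[OF \<alpha>]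
          intro: subspace_diff subspace_scale)
    ultimately show ?thesis by simp
  qed
  moreover have "\<forall>i<Suc n. a' i \<in> A \<and> linear_form scale (a' i)"
    using a cuts_Suc.hyps by (auto simp: a'_def less_Suc_eq)
  ultimately show ?case by blast
qed auto

end

lemma (in finite_dimensional_vector_space) finite_UNIV_of_finite_field:
  assumes "finite (UNIV :: 'a set)"
  shows "finite (UNIV :: 'b set)"
proof -
  have "(UNIV :: 'b set) \<subseteq> (\<lambda>c. \<Sum>v\<in>Basis. scale (c v) v) ` (Basis \<rightarrow>\<^sub>E UNIV)"
  proof
    fix x :: 'b
    have "x \<in> span Basis" by (simp add: span_Basis)
    then obtain c where c: "x = (\<Sum>v\<in>Basis. scale (c v) v)"
      using span_finite[OF finite_Basis] by auto
    also have "\<dots> = (\<Sum>v\<in>Basis. scale (restrict c Basis v) v)"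
      by (rule sum.cong) auto
    finally show "x \<in> (\<lambda>c. \<Sum>v\<in>Basis. scale (c v) v) ` (Basis \<rightarrow>\<^sub>E UNIV)"
      by (intro image_eqI[of _ _ "restrict c Basis"]) auto
  qed
  moreover have "finite (Basis \<rightarrow>\<^sub>E (UNIV :: 'a set))"
    using finite_Basis assms by (intro finite_PiE) auto
  ultimately show ?thesis by (meson finite_imageI finite_subset)
qed

lemma finite_space_of_basis:
  fixes s :: "'k::{field,finite} \<Rightarrow> 'a::ab_group_add \<Rightarrow> 'a"
  assumes "finite_dimensional_vector_space s B"
  shows "finite_space s"
  using assms finite_dimensional_vector_space.finite_UNIV_of_finite_field[OF assms]
  by (auto simp: finite_space_def finite_space_axioms_def finite_dimensional_vector_space_def)

section \<open>A point with large autocorrelation\<close>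

text \<open>
  Here \<open>M\<close> is the mean of \<open>g\<close>. Summed over all \<open>x\<close>, with \<open>N\<close> the number of elements, the left
  side gives \<open>N M\<^sup>2\<close>, and the right side at most that, because \<open>y \<mapsto> y powr p\<close> is concave.
\<close>

lemma exists_large_autocorrelation:
  fixes g :: "'a::ab_group_add \<Rightarrow> real"
  assumes fin: "finite (UNIV :: 'a set)" and pos: "\<And>x. g x > 0" and p: "0 \<le> p" "p \<le> 1"
  defines "M \<equiv> (\<Sum>x\<in>UNIV. g x) / real CARD('a)"
  shows "\<exists>x. (\<Sum>y\<in>UNIV. g y * g (x - y)) / real CARD('a) \<ge> M powr (2 - p) * g x powr p"
proof (rule ccontr)
  define N where "N = real CARD('a)"
  have N: "N > 0" using fin by (simp add: N_def finite_UNIV_card_ge_0)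
  have Mpos: "M > 0"
    unfolding M_def using pos N fin by (auto intro!: divide_pos_pos sum_pos simp: N_def)
  have sum_g: "(\<Sum>x\<in>UNIV. g x) = N * M" using N by (simp add: M_def N_def)
  assume "\<not> ?thesis"
  then have less: "(\<Sum>y\<in>UNIV. g y * g (x - y)) / N < M powr (2 - p) * g x powr p" for x
    by (auto simp: N_def not_le)
  have "(\<Sum>x\<in>UNIV. \<Sum>y\<in>UNIV. g y * g (x - y)) = (\<Sum>y\<in>UNIV. \<Sum>x\<in>UNIV. g y * g (x - y))"
    by (rule sum.swap)
  also have "\<dots> = (\<Sum>y\<in>UNIV. g y * (\<Sum>z\<in>UNIV. g z))"
  proof (rule sum.cong[OF refl])
    fix y
    have "(\<Sum>x\<in>UNIV. g (x - y)) = (\<Sum>z\<in>UNIV. g z)"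
      by (rule sum.reindex_bij_witness[where i = "\<lambda>z. z + y" and j = "\<lambda>x. x - y"]) auto
    then show "(\<Sum>x\<in>UNIV. g y * g (x - y)) = g y * (\<Sum>z\<in>UNIV. g z)"
      by (simp add: sum_distrib_left[symmetric])
  qed
  also have "\<dots> = (N * M) * (N * M)"
    by (simp add: sum_distrib_right[symmetric] sum_g)
  finally have "N * M * M = (\<Sum>x\<in>UNIV. (\<Sum>y\<in>UNIV. g y * g (x - y)) / N)"
    using N by (simp add: sum_divide_distrib[symmetric])
  also have "\<dots> < (\<Sum>x\<in>UNIV. M powr (2 - p) * g x powr p)"
    using less fin by (intro sum_strict_mono) auto
  also have "\<dots> \<le> (\<Sum>x\<in>UNIV. M * (p * g x + (1 - p) * M))"
  proof (rule sum_mono)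
    fix x
    have "M powr (2 - p) * g x powr p = M * (g x powr p * M powr (1 - p))"
      using Mpos powr_add[of M 1 "1 - p"] by (simp add: mult_ac)
    also have "\<dots> \<le> M * (p * g x + (1 - p) * M)"
      using Youngs_inequality_0[of p "1 - p" "g x" M] p pos Mpos by auto
    finally show "M powr (2 - p) * g x powr p \<le> M * (p * g x + (1 - p) * M)" .
  qed
  also have "\<dots> = M * (p * (N * M) + (1 - p) * (N * M))"
    by (simp add: sum_distrib_left[symmetric] sum.distrib sum_g N_def)
  also have "\<dots> = N * M * M" by (simp add: algebra_simps)
  finally show False by simp
qed

section \<open>Kernels and rank moments of a trilinear form\<close>

text \<open>A trilinear form \<open>f\<close> on three finite vector spaces over a finite field.\<close>

locale finite_trilinear =
  U: finite_space sU + V: finite_space sV + W: finite_space sW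
  for sU :: "'k::{field,finite} \<Rightarrow> 'u::ab_group_add \<Rightarrow> 'u"
    and sV :: "'k \<Rightarrow> 'v::ab_group_add \<Rightarrow> 'v"
    and sW :: "'k \<Rightarrow> 'w::ab_group_add \<Rightarrow> 'w" +
  fixes f :: "'u \<Rightarrow> 'v \<Rightarrow> 'w \<Rightarrow> 'k"
  assumes trilinear: "trilinear_form sU sV sW f"
begin

lemma linear_U: "linear_form sU (\<lambda>u. f u v w)"
  and linear_V: "linear_form sV (\<lambda>v. f u v w)"
  and linear_W: "linear_form sW (\<lambda>w. f u v w)"
  using trilinear by (auto simp: trilinear_form_def)

lemmas f_U = U.linear_form_add[OF linear_U] U.linear_form_scale[OF linear_U]
  U.linear_form_diff[OF linear_U] U.linear_form_sum[OF linear_U] U.linear_form_zero[OF linear_U]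
lemmas f_V = V.linear_form_add[OF linear_V] V.linear_form_scale[OF linear_V]
  V.linear_form_diff[OF linear_V] V.linear_form_sum[OF linear_V] V.linear_form_zero[OF linear_V]
lemmas f_W = W.linear_form_add[OF linear_W] W.linear_form_scale[OF linear_W]
  W.linear_form_diff[OF linear_W] W.linear_form_sum[OF linear_W] W.linear_form_zero[OF linear_W]

text \<open>The linear forms on \<open>U\<close>, \<open>V\<close>, \<open>W\<close> obtained from \<open>f\<close> by fixing the other two arguments.\<close>

definition formsU where "formsU = {\<lambda>u. f u v0 w0 | v0 w0. True}"
definition formsV where "formsV = {\<lambda>v. f u0 v w0 | u0 w0. True}"
definition formsW where "formsW = {\<lambda>w. f u0 v0 w | u0 v0. True}"

text \<open>
  The left and right kernels of the bilinear form \<open>f u\<close> restricted to \<open>V0 \<times> W0\<close>, the density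
  \<open>q powr (- r)\<close> of the left one in \<open>V0\<close>, where \<open>r\<close> is the rank of that restriction, and the
  average of \<open>q powr (- s r)\<close> over \<open>u\<close>.
\<close>

definition lker where "lker V0 W0 u = {v \<in> V0. \<forall>w\<in>W0. f u v w = 0}"
definition rker where "rker V0 W0 u = {w \<in> W0. \<forall>v\<in>V0. f u v w = 0}"
definition dens :: "'v set \<Rightarrow> 'w set \<Rightarrow> 'u \<Rightarrow> real" where
  "dens V0 W0 u = real (card (lker V0 W0 u)) / real (card V0)"
definition moment :: "nat \<Rightarrow> 'v set \<Rightarrow> 'w set \<Rightarrow> real" where
  "moment s V0 W0 = (\<Sum>u\<in>UNIV. dens V0 W0 u ^ s) / real CARD('u)"

lemma lker_eq_zeros: "lker V0 W0 u = {v \<in> V0. \<forall>\<beta>\<in>(\<lambda>w v. f u v w) ` W0. \<beta> v = 0}"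
  by (auto simp: lker_def)

lemma rker_eq_zeros: "rker V0 W0 u = {w \<in> W0. \<forall>\<gamma>\<in>f u ` V0. \<gamma> w = 0}"
  by (auto simp: rker_def)

lemma subspace_lker: "V.subspace V0 \<Longrightarrow> V.subspace (lker V0 W0 u)"
  unfolding lker_eq_zeros by (rule V.subspace_zeros) (auto simp: linear_V)

lemma lker_subset: "lker V0 W0 u \<subseteq> V0"
  by (auto simp: lker_def)

lemma dens_pos: "V.subspace V0 \<Longrightarrow> dens V0 W0 u > 0"
  unfolding dens_def
  using V.card_subspace_pos[OF subspace_lker] V.card_subspace_pos by auto

lemma moment_pos: "V.subspace V0 \<Longrightarrow> moment s V0 W0 > 0"
  unfolding moment_def
  using U.finite_UNIV
  by (intro divide_pos_pos sum_pos) (auto simp: dens_pos finite_UNIV_card_ge_0)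

lemma dens_le_1: "dens V0 W0 u \<le> 1"
  using card_mono[OF _ lker_subset[of V0 W0 u]] by (auto simp: dens_def divide_le_eq_1)

lemma moment_le_1: "V.subspace V0 \<Longrightarrow> moment s V0 W0 \<le> 1"
  unfolding moment_def
  using U.finite_UNIV
    sum_mono[of UNIV "\<lambda>u. dens V0 W0 u ^ s" "\<lambda>u. 1"] dens_pos[of V0 W0] dens_le_1[of V0 W0]
  by (simp add: divide_le_eq_1 power_le_one less_imp_le finite_UNIV_card_ge_0)

lemma card_field: "CARD('k) \<ge> 2"
proof -
  have "card {0, 1 :: 'k} \<le> CARD('k)" by (intro card_mono) auto
  then show ?thesis by simp
qed

text \<open>
  Row rank equals column rank: both sides come from counting the zeros of \<open>f u\<close> in \<open>V0 \<times> W0\<close>, by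
  rows and by columns.
\<close>

lemma card_lker_rker:
  assumes V0: "V.subspace V0" and W0: "W.subspace W0"
  shows "card (lker V0 W0 u) * card W0 = card V0 * card (rker V0 W0 u)"
proof -
  let ?q = "CARD('k)"
  let ?Z = "\<lambda>v w. if f u v w = 0 then 1 else (0::nat)"
  have row: "?q * (\<Sum>w\<in>W0. ?Z v w)
      = card W0 + (if v \<in> lker V0 W0 u then (?q - 1) * card W0 else 0)" if "v \<in> V0" for v
    using W.card_kernel_cases[OF W0 linear_W, of u v] that
    by (simp add: lker_def sum.If_cases Int_def)
  have col: "?q * (\<Sum>v\<in>V0. ?Z v w)
      = card V0 + (if w \<in> rker V0 W0 u then (?q - 1) * card V0 else 0)" if "w \<in> W0" for w
    using V.card_kernel_cases[OF V0 linear_V, of u w] that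
    by (simp add: rker_def sum.If_cases Int_def)
  have "?q * (\<Sum>v\<in>V0. \<Sum>w\<in>W0. ?Z v w)
      = (\<Sum>v\<in>V0. card W0 + (if v \<in> lker V0 W0 u then (?q - 1) * card W0 else 0))"
    unfolding sum_distrib_left[of ?q "\<lambda>v. \<Sum>w\<in>W0. ?Z v w"] by (rule sum.cong) (simp_all only: row)
  also have "\<dots> = card V0 * card W0 + card (lker V0 W0 u) * ((?q - 1) * card W0)"
  proof -
    have "{x \<in> V0. x \<in> lker V0 W0 u} = lker V0 W0 u" using lker_subset by auto
    then show ?thesis by (simp add: sum.distrib sum.If_cases Int_def)
  qed
  finally have 1: "?q * (\<Sum>v\<in>V0. \<Sum>w\<in>W0. ?Z v w)
      = card V0 * card W0 + card (lker V0 W0 u) * ((?q - 1) * card W0)" .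
  have "?q * (\<Sum>w\<in>W0. \<Sum>v\<in>V0. ?Z v w)
      = (\<Sum>w\<in>W0. card V0 + (if w \<in> rker V0 W0 u then (?q - 1) * card V0 else 0))"
    unfolding sum_distrib_left[of ?q "\<lambda>w. \<Sum>v\<in>V0. ?Z v w"] by (rule sum.cong) (simp_all only: col)
  also have "\<dots> = card W0 * card V0 + card (rker V0 W0 u) * ((?q - 1) * card V0)"
  proof -
    have "{x \<in> W0. x \<in> rker V0 W0 u} = rker V0 W0 u" by (auto simp: rker_def)
    then show ?thesis by (simp add: sum.distrib sum.If_cases Int_def)
  qed
  finally have 2: "?q * (\<Sum>w\<in>W0. \<Sum>v\<in>V0. ?Z v w)
      = card W0 * card V0 + card (rker V0 W0 u) * ((?q - 1) * card V0)" .
  have "(\<Sum>v\<in>V0. \<Sum>w\<in>W0. ?Z v w) = (\<Sum>w\<in>W0. \<Sum>v\<in>V0. ?Z v w)" by (rule sum.swap)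
  with 1 2 have "card (lker V0 W0 u) * ((?q - 1) * card W0)
      = card (rker V0 W0 u) * ((?q - 1) * card V0)"
    by (metis add_left_cancel mult.commute)
  then have "(?q - 1) * (card (lker V0 W0 u) * card W0)
      = (?q - 1) * (card V0 * card (rker V0 W0 u))"
    by (simp only: mult_ac)
  moreover have "?q - 1 \<noteq> 0" using card_field by simp
  ultimately show ?thesis by (metis mult_cancel1)
qed

text \<open>
  For bilinear forms \<open>B\<close>, \<open>C\<close> with sum \<open>A\<close>, let \<open>B'\<close> be the restriction of \<open>B\<close> to the left times
  the right kernel of \<open>A\<close>; then \<open>rank A + 2 rank B' \<le> rank B + rank C\<close>. Here \<open>B = f u\<close> and
  \<open>A = f u0\<close>. The left kernels of \<open>B\<close> and \<open>C\<close> both lie in \<open>V2\<close>, the set of \<open>v\<close> with \<open>B\<close>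
  vanishing on \<open>v\<close> times the right kernel of \<open>A\<close>, and their intersection lies in the left
  kernel of \<open>B'\<close>, which is \<open>V2\<close> intersected with the left kernel of \<open>A\<close>.
\<close>

lemma dens_restrict:
  assumes V0: "V.subspace V0"
  shows "dens V0 W0 u * dens V0 W0 (u0 - u)
           \<le> dens (lker V0 W0 u0) (rker V0 W0 u0) u ^ 2 * dens V0 W0 u0"
proof -
  define V1 where "V1 = lker V0 W0 u0"
  define W1 where "W1 = rker V0 W0 u0"
  define V2 where "V2 = lker V0 W1 u"
  define X where "X = lker V0 W0 u"
  define Y where "Y = lker V0 W0 (u0 - u)"
  define K where "K = lker V1 W1 u"
  note defs = V1_def W1_def V2_def X_def Y_def K_def
  have sub: "V.subspace V1" "V.subspace V2" "V.subspace X" "V.subspace Y"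
    unfolding defs by (intro subspace_lker V0)+
  have XY: "card X * card Y \<le> card V2 * card (X \<inter> Y)"
    by (rule V.card_subspaces_mult_le) (use sub in \<open>auto simp: defs lker_def rker_def f_U\<close>)
  have "X \<inter> Y \<subseteq> K"
    by (auto simp: defs lker_def rker_def f_U)
  then have "card (X \<inter> Y) \<le> card K" by (intro card_mono) auto
  with XY have 1: "card X * card Y \<le> card V2 * card K"
    by (meson le_trans mult_le_mono2)
  have "V2 \<inter> V1 = K" by (auto simp: defs lker_def)
  then have 2: "card V2 * card V1 \<le> card V0 * card K"
    using V.card_subspaces_mult_le[of V2 V0 V1] sub V0 by (auto simp: defs lker_subset)
  have "card X * card Y * card V1 \<le> card V2 * card K * card V1"
    using 1 by (rule mult_le_mono1)
  also have "\<dots> = (card V2 * card V1) * card K" by simp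
  also have "\<dots> \<le> (card V0 * card K) * card K" using 2 by (rule mult_le_mono1)
  finally have "real (card X * card Y * card V1) \<le> real (card V0 * card K * card K)"
    by (rule of_nat_mono)
  moreover have "real (card V0) > 0" "real (card V1) > 0"
    using V.card_subspace_pos[OF V0] V.card_subspace_pos[OF sub(1)] by linarith+
  moreover have "x / a * (y / a) \<le> (k / b) ^ 2 * (b / a)"
    if "x * y * b \<le> a * k * k" "a > 0" "b > 0" for x y k a b :: real
    using that by (simp add: field_simps power2_eq_square)
  ultimately have "real (card X) / card V0 * (real (card Y) / card V0)
      \<le> (real (card K) / card V1) ^ 2 * (real (card V1) / card V0)"
    by simp
  then show ?thesis by (simp add: dens_def defs)
qed

text \<open>
  The factor \<open>2\<close> of \<open>rank B'\<close> above, the exponent in \<open>dens_restrict\<close>, is why \<open>s\<close> doubles.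
\<close>

lemma moment_step:
  assumes V0: "V.subspace V0" and s: "s > 0"
  defines "p \<equiv> real s / (real s + 2)"
  shows "\<exists>u0. moment (2 * s) (lker V0 W0 u0) (rker V0 W0 u0)
            \<ge> moment s V0 W0 powr (2 - p) * (dens V0 W0 u0 ^ s) powr (p - 1)"
proof -
  define g where "g u = dens V0 W0 u ^ s" for u
  have g: "g u > 0" for u using dens_pos[OF V0] by (simp add: g_def)
  have p: "0 \<le> p" "p \<le> 1" by (auto simp: p_def)
  obtain u0 where u0: "moment s V0 W0 powr (2 - p) * g u0 powr p
      \<le> (\<Sum>u\<in>UNIV. g u * g (u0 - u)) / real CARD('u)"
    using exists_large_autocorrelation[of g p, OF U.finite_UNIV g p] unfolding moment_def g_def by auto
  let ?V1 = "lker V0 W0 u0" and ?W1 = "rker V0 W0 u0"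
  have "g u * g (u0 - u) \<le> dens ?V1 ?W1 u ^ (2 * s) * g u0" for u
  proof -
    have "(dens V0 W0 u * dens V0 W0 (u0 - u)) ^ s \<le> (dens ?V1 ?W1 u ^ 2 * dens V0 W0 u0) ^ s"
      using dens_restrict[OF V0] dens_pos[OF V0] by (intro power_mono) (auto simp: less_imp_le)
    then show ?thesis by (simp add: g_def power_mult_distrib power_mult)
  qed
  then have "(\<Sum>u\<in>UNIV. g u * g (u0 - u)) \<le> (\<Sum>u\<in>UNIV. dens ?V1 ?W1 u ^ (2 * s) * g u0)"
    by (intro sum_mono)
  then have "(\<Sum>u\<in>UNIV. g u * g (u0 - u)) / real CARD('u) \<le> moment (2 * s) ?V1 ?W1 * g u0"
    by (simp add: moment_def sum_distrib_right[symmetric] divide_right_mono)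
  with u0 have "moment s V0 W0 powr (2 - p) * g u0 powr p \<le> moment (2 * s) ?V1 ?W1 * g u0"
    by linarith
  then have "moment s V0 W0 powr (2 - p) * (g u0 powr p / g u0) \<le> moment (2 * s) ?V1 ?W1"
    using g[of u0] by (simp add: field_simps)
  moreover have "g u0 powr p / g u0 = g u0 powr (p - 1)"
    using g[of u0] by (simp add: powr_diff)
  ultimately show ?thesis unfolding g_def by auto
qed

section \<open>Iterating the step\<close>

text \<open>
  The previous lemma in logarithmic form: \<open>V1\<close> and \<open>W1\<close> are the kernels of a form \<open>f u0\<close> of rank \<open>r\<close>
  on \<open>V0 \<times> W0\<close>, so both codimensions grow by \<open>r\<close>.
\<close>

lemma potential_step:
  assumes a: "V.cuts formsV a V0" and b: "W.cuts formsW b W0" and s: "s > 0"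
  shows "\<exists>r V1 W1. V.cuts formsV (a + r) V1 \<and> W.cuts formsW (b + r) W1 \<and>
           2 * real r + (1 + 4 / real (2 * s)) * (- log (real CARD('k)) (moment (2 * s) V1 W1))
             \<le> (1 + 4 / real s) * (- log (real CARD('k)) (moment s V0 W0))"
proof -
  let ?q = "CARD('k)" and ?lg = "log (real CARD('k))"
  have q: "real ?q > 1" using card_field by linarith
  have V0: "V.subspace V0" and W0: "W.subspace W0"
    using a b V.cuts_subspace W.cuts_subspace by auto
  \<comment> \<open>With this \<open>p\<close>, the factor \<open>(1 - p) s r\<close> below becomes \<open>2 r\<close> on multiplication by \<open>(s + 2) / s\<close>.\<close>
  define p where "p = real s / (real s + 2)"
  obtain u0 where u0: "moment (2 * s) (lker V0 W0 u0) (rker V0 W0 u0)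
      \<ge> moment s V0 W0 powr (2 - p) * (dens V0 W0 u0 ^ s) powr (p - 1)"
    using moment_step[OF V0 s] unfolding p_def by blast
  define V1 where "V1 = lker V0 W0 u0"
  define W1 where "W1 = rker V0 W0 u0"
  obtain r where r: "V.cuts formsV (a + r) V1"
    using V.cuts_zeros[OF a, of "(\<lambda>w v. f u0 v w) ` W0"] linear_V
    unfolding V1_def lker_eq_zeros formsV_def by blast
  obtain r' where r': "W.cuts formsW (b + r') W1"
    using W.cuts_zeros[OF b, of "f u0 ` V0"] linear_W
    unfolding W1_def rker_eq_zeros formsW_def by blast
  have cV: "card V1 * ?q ^ r = card V0"
  proof -
    have "card V1 * ?q ^ r * ?q ^ a = card V0 * ?q ^ a"
      using V.cuts_card[OF a] V.cuts_card[OF r] by (simp add: power_add mult_ac)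
    then show ?thesis using card_field by simp
  qed
  have cW: "card W1 * ?q ^ r' = card W0"
  proof -
    have "card W1 * ?q ^ r' * ?q ^ b = card W0 * ?q ^ b"
      using W.cuts_card[OF b] W.cuts_card[OF r'] by (simp add: power_add mult_ac)
    then show ?thesis using card_field by simp
  qed
  have pos: "card V1 > 0" "card W1 > 0" "card V0 > 0"
    using V.card_subspace_pos[OF V.cuts_subspace[OF r]]
      W.card_subspace_pos[OF W.cuts_subspace[OF r']] V.card_subspace_pos[OF V0] by auto
  have "card V1 * card W0 = card V0 * card W1"
    unfolding V1_def W1_def by (rule card_lker_rker[OF V0 W0])
  then have "(card V1 * card W1) * ?q ^ r' = (card V1 * card W1) * ?q ^ r"
    unfolding cV[symmetric] cW[symmetric] by (simp only: mult_ac)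
  moreover have "0 < card V1 * card W1" using pos by (intro mult_pos_pos)
  ultimately have "?q ^ r' = ?q ^ r" by (simp only: mult_cancel1) (metis less_irrefl)
  then have rr: "r' = r"
    using card_field power_inject_exp[of ?q r' r] by simp
  have "dens V0 W0 u0 = real (card V1) / real (card V1 * ?q ^ r)"
    unfolding dens_def V1_def[symmetric] cV ..
  also have "\<dots> = 1 / real ?q ^ r"
  proof -
    have "real (card V1) \<noteq> 0" using pos by linarith
    then show ?thesis by (simp del: of_nat_eq_0_iff card_eq_0_iff card_0_eq)
  qed
  finally have dens: "dens V0 W0 u0 = 1 / real ?q ^ r" .
  define M where "M = moment s V0 W0"
  have M: "M > 0" using moment_pos[OF V0] by (simp add: M_def)
  define D where "D = dens V0 W0 u0 ^ s"
  have D: "D > 0" using dens_pos[OF V0] by (simp add: D_def)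
  have lgD: "?lg D = - (real s * real r)"
    unfolding D_def dens using q by (simp add: power_divide power_mult[symmetric] log_divide
        log_nat_power)
  define L where "L = ?lg M"
  define L1 where "L1 = ?lg (moment (2 * s) V1 W1)"
  have "(2 - p) * L + (1 - p) * (real s * real r) = (2 - p) * L + (p - 1) * ?lg D"
    unfolding lgD by (simp add: algebra_simps)
  also have "\<dots> = ?lg (M powr (2 - p) * D powr (p - 1))"
    using M D q by (simp add: log_mult log_powr L_def)
  also have "\<dots> \<le> L1"
    unfolding L1_def
  proof (subst log_le_cancel_iff)
    show "M powr (2 - p) * D powr (p - 1) \<le> moment (2 * s) V1 W1"
      using u0 unfolding M_def D_def V1_def W1_def .
    show "0 < moment (2 * s) V1 W1"
      by (rule moment_pos[OF V.cuts_subspace[OF r]])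
  qed (use M D q in auto)
  finally have main: "(2 - p) * L + (1 - p) * (real s * real r) \<le> L1" .
  have "(real s + 2) * ((2 - p) * L + (1 - p) * (real s * real r))
      = 2 * (real s + 2) * L - ((real s + 2) * p) * L
          + ((real s + 2) - (real s + 2) * p) * (real s * real r)"
    by (simp add: algebra_simps)
  also have "(real s + 2) * p = real s" by (simp add: p_def)
  finally have "(real s + 2) * ((2 - p) * L + (1 - p) * (real s * real r))
      = (real s + 4) * L + 2 * real s * real r"
    by (simp add: algebra_simps)
  moreover have "(real s + 2) * ((2 - p) * L + (1 - p) * (real s * real r)) \<le> (real s + 2) * L1"
    using main by (rule mult_left_mono) simp
  ultimately have "((real s + 4) * L + 2 * real s * real r) / real s \<le> (real s + 2) * L1 / real s"
    by (intro divide_right_mono) auto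
  moreover
  have "((real s + 4) * L + 2 * real s * real r) / real s = (1 + 4 / real s) * L + 2 * real r"
      "(real s + 2) * L1 / real s = (1 + 4 / real (2 * s)) * L1"
    using s by (simp_all add: add_divide_distrib distrib_right)
  ultimately have "2 * real r + (1 + 4 / real (2 * s)) * (- L1) \<le> (1 + 4 / real s) * (- L)"
    by simp
  with r r' rr show ?thesis
    unfolding M_def L_def L1_def by (intro exI[of _ r] exI[of _ V1] exI[of _ W1] conjI) simp_all
qed

lemma moment_1_UNIV:
  "- log (real CARD('k)) (moment 1 UNIV UNIV) = analytic_rank f"
proof -
  have "{(u, v). \<forall>w. f u v w = 0} = Sigma UNIV (lker UNIV UNIV)"
    by (auto simp: lker_def)
  then have "card {(u, v). \<forall>w. f u v w = 0} = (\<Sum>u\<in>UNIV. card (lker UNIV UNIV u))"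
    using U.finite_UNIV by (simp add: card_SigmaI)
  then show ?thesis
    by (simp add: analytic_rank_def moment_def dens_def sum_divide_distrib[symmetric] mult_ac)
qed

lemma iterated_potential:
  "\<exists>a b V0 W0. V.cuts formsV a V0 \<and> W.cuts formsW b W0 \<and>
     real a + real b + (1 + 4 / real (2 ^ j)) * (- log (real CARD('k)) (moment (2 ^ j) V0 W0))
       \<le> 5 * analytic_rank f"
proof (induction j)
  case 0
  have "V.cuts formsV 0 UNIV" "W.cuts formsW 0 UNIV" by (rule V.cuts_UNIV W.cuts_UNIV)+
  moreover have "real 0 + real 0
      + (1 + 4 / real (2 ^ 0)) * (- log (real CARD('k)) (moment (2 ^ 0) UNIV UNIV))
      \<le> 5 * analytic_rank f"
    using moment_1_UNIV by simp
  ultimately show ?case by blast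
next
  case (Suc j)
  then obtain a b V0 W0 where ab: "V.cuts formsV a V0" "W.cuts formsW b W0"
    and le: "real a + real b
        + (1 + 4 / real (2 ^ j)) * (- log (real CARD('k)) (moment (2 ^ j) V0 W0))
       \<le> 5 * analytic_rank f" by blast
  obtain r V1 W1 where r: "V.cuts formsV (a + r) V1" "W.cuts formsW (b + r) W1"
    and "2 * real r + (1 + 4 / real (2 * 2 ^ j)) * (- log (real CARD('k)) (moment (2 * 2 ^ j) V1 W1))
             \<le> (1 + 4 / real (2 ^ j)) * (- log (real CARD('k)) (moment (2 ^ j) V0 W0))"
    using potential_step[OF ab, of "2 ^ j"] by auto
  with le have "real (a + r) + real (b + r)
      + (1 + 4 / real (2 ^ Suc j)) * (- log (real CARD('k)) (moment (2 ^ Suc j) V1 W1))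
      \<le> 5 * analytic_rank f"
    by simp
  with r show ?case by blast
qed

text \<open>A nonzero bilinear form has rank at least \<open>1\<close>.\<close>

lemma dens_cases:
  assumes V0: "V.subspace V0"
  shows "dens V0 W0 u \<le> 1 / real CARD('k) \<or> (\<forall>v\<in>V0. \<forall>w\<in>W0. f u v w = 0)"
proof (cases "\<forall>v\<in>V0. \<forall>w\<in>W0. f u v w = 0")
  case False
  then obtain v w where vw: "v \<in> V0" "w \<in> W0" "f u v w \<noteq> 0" by blast
  have "lker V0 W0 u \<subseteq> {v \<in> V0. f u v w = 0}" using vw by (auto simp: lker_def)
  then have "card (lker V0 W0 u) \<le> card {v \<in> V0. f u v w = 0}" by (intro card_mono) auto
  moreover have "card V0 = CARD('k) * card {v \<in> V0. f u v w = 0}"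
    using V.card_kernel[OF V0 linear_V, of v u w] vw by simp
  ultimately have "CARD('k) * card (lker V0 W0 u) \<le> card V0" by simp
  then have "real (CARD('k) * card (lker V0 W0 u)) \<le> real (card V0)" by (rule of_nat_mono)
  then show ?thesis
    using V.card_subspace_pos[OF V0] card_field by (simp add: dens_def field_simps)
qed simp

text \<open>
  For large \<open>s\<close> the points \<open>u\<close> with \<open>f u\<close> nonzero on \<open>V0 \<times> W0\<close> contribute to the sum over \<open>u\<close>
  at most \<open>1\<close>, hence no more than the vanishing ones do.
\<close>

lemma codim_vanishing_le:
  assumes V0: "V.subspace V0" and s: "CARD('u) \<le> CARD('k) ^ s"
    and c: "U.cuts A c {u. \<forall>v\<in>V0. \<forall>w\<in>W0. f u v w = 0}"
  shows "real c \<le> - log (real CARD('k)) (moment s V0 W0) + 1"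
proof -
  let ?q = "real CARD('k)" and ?T = "{u. \<forall>v\<in>V0. \<forall>w\<in>W0. f u v w = 0}"
  have q: "?q \<ge> 2" using card_field by linarith
  have N: "CARD('u) > 0" using U.finite_UNIV by (simp add: finite_UNIV_card_ge_0)
  have T: "card ?T > 0" using U.card_subspace_pos[OF U.cuts_subspace[OF c]] .
  have card: "real CARD('u) = real (card ?T) * ?q ^ c"
    unfolding U.cuts_card[OF c, symmetric] by simp
  have sN: "real CARD('u) \<le> ?q ^ s" using s by (metis of_nat_mono of_nat_power)
  have "dens V0 W0 u ^ s \<le> (if u \<in> ?T then 1 else 0) + 1 / ?q ^ s" for u
  proof (cases "u \<in> ?T")
    case True
    have "dens V0 W0 u ^ s \<le> 1"
      using dens_le_1 dens_pos[OF V0, of W0 u] by (intro power_le_one) auto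
    with True show ?thesis by (simp add: add_increasing2)
  next
    case False
    then have "dens V0 W0 u \<le> 1 / ?q" using dens_cases[OF V0, of W0 u] by auto
    then have "dens V0 W0 u ^ s \<le> (1 / ?q) ^ s"
      using dens_pos[OF V0, of W0 u] by (intro power_mono) auto
    with False show ?thesis by (simp add: power_divide)
  qed
  then have "(\<Sum>u\<in>UNIV. dens V0 W0 u ^ s) \<le> (\<Sum>u\<in>UNIV. (if u \<in> ?T then 1 else 0) + 1 / ?q ^ s)"
    by (intro sum_mono)
  also have "\<dots> = real (card ?T) + real CARD('u) / ?q ^ s"
    using U.finite_UNIV by (simp add: sum.distrib sum.If_cases)
  also have "\<dots> \<le> 2 * real (card ?T)"
  proof -
    have "real CARD('u) / ?q ^ s \<le> 1" using sN q by simp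
    moreover have "1 \<le> real (card ?T)" using T by linarith
    ultimately show ?thesis by linarith
  qed
  finally have "moment s V0 W0 \<le> 2 * real (card ?T) / real CARD('u)"
    unfolding moment_def by (rule divide_right_mono) simp
  also have "\<dots> = 2 / ?q ^ c"
  proof -
    have "2 * t / (t * x) = 2 / x" if "t \<noteq> 0" for t x :: real
      using that by simp
    moreover have "real (card ?T) \<noteq> 0" using T by linarith
    ultimately show ?thesis unfolding card .
  qed
  also have "\<dots> \<le> ?q / ?q ^ c" using q by (intro divide_right_mono) auto
  finally have "log (real CARD('k)) (moment s V0 W0) \<le> log (real CARD('k)) (?q / ?q ^ c)"
    using q moment_pos[OF V0] by (subst log_le_cancel_iff) auto
  also have "\<dots> = 1 - real c" using q by (simp add: log_divide log_nat_power)
  finally show ?thesis by simp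
qed

section \<open>The slice decomposition\<close>

lemma sum_of_add:
  assumes "sum_of m S g" "sum_of n S h"
  shows "sum_of (m + n) S (\<lambda>u v w. g u v w + (h u v w :: 'k))"
proof -
  obtain g' h' where g': "\<And>i. i < m \<Longrightarrow> g' i \<in> S" "\<And>u v w. g u v w = (\<Sum>i<m. g' i u v w)"
    and h': "\<And>i. i < n \<Longrightarrow> h' i \<in> S" "\<And>u v w. h u v w = (\<Sum>i<n. h' i u v w)"
    using assms unfolding sum_of_def by metis
  define k where "k i = (if i < m then g' i else h' (i - m))" for i
  have "(\<Sum>i<m + n. k i u v w) = g u v w + h u v w" for u v w
  proof -
    have "(\<Sum>i<m + n. k i u v w) = (\<Sum>i<m. k i u v w) + (\<Sum>i<n. k (m + i) u v w)"
      by (induction n) (simp_all add: add.assoc)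
    then show ?thesis by (simp add: k_def g'(2) h'(2))
  qed
  moreover have "\<forall>i<m + n. k i \<in> S" using g'(1) h'(1) by (auto simp: k_def)
  ultimately show ?thesis unfolding sum_of_def by metis
qed

lemma fixed_coordinate_sliceU:
  "\<alpha> \<in> formsU \<Longrightarrow> linear_form sU \<alpha> \<Longrightarrow> bilinear_form sV sW h
     \<Longrightarrow> (\<lambda>u v w. \<alpha> u * h v w) \<in> fixed_coordinate_slices sU sV sW f"
  unfolding fixed_coordinate_slices_def slices_def formsU_def
  by (rule UnI1, rule UnI1) (rule CollectI, intro exI conjI, rule refl, simp_all)

lemma fixed_coordinate_sliceV:
  "\<beta> \<in> formsV \<Longrightarrow> linear_form sV \<beta> \<Longrightarrow> bilinear_form sU sW h
     \<Longrightarrow> (\<lambda>u v w. \<beta> v * h u w) \<in> fixed_coordinate_slices sU sV sW f"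
  unfolding fixed_coordinate_slices_def slices_def formsV_def
  by (rule UnI1, rule UnI2) (rule CollectI, intro exI conjI, rule refl, simp_all)

lemma fixed_coordinate_sliceW:
  "\<gamma> \<in> formsW \<Longrightarrow> linear_form sW \<gamma> \<Longrightarrow> bilinear_form sU sV h
     \<Longrightarrow> (\<lambda>u v w. \<gamma> w * h u v) \<in> fixed_coordinate_slices sU sV sW f"
  unfolding fixed_coordinate_slices_def slices_def formsW_def
  by (rule UnI2) (rule CollectI, intro exI conjI, rule refl, simp_all)

lemma slices_of_vanishing:
  assumes c: "U.cuts formsU c T" and a: "V.cuts formsV a V0" and b: "W.cuts formsW b W0"
    and zero: "\<And>u v w. u \<in> T \<Longrightarrow> v \<in> V0 \<Longrightarrow> w \<in> W0 \<Longrightarrow> f u v w = 0"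
  shows "sum_of (c + a + b) (fixed_coordinate_slices sU sV sW f) f"
proof -
  let ?S = "fixed_coordinate_slices sU sV sW f"
  \<comment> \<open>Project one argument after the other into \<open>T\<close>, \<open>V0\<close>, \<open>W0\<close>, collecting the correction terms.\<close>
  obtain \<alpha> d where \<alpha>: "\<And>i. i < c \<Longrightarrow> \<alpha> i \<in> formsU \<and> linear_form sU (\<alpha> i)"
    and d: "\<And>u. u - (\<Sum>i<c. sU (\<alpha> i u) (d i)) \<in> T"
    using U.cuts_projection[OF c] by blast
  obtain \<beta> d' where \<beta>: "\<And>i. i < a \<Longrightarrow> \<beta> i \<in> formsV \<and> linear_form sV (\<beta> i)"
    and d': "\<And>v. v - (\<Sum>i<a. sV (\<beta> i v) (d' i)) \<in> V0"
    using V.cuts_projection[OF a] by blast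
  obtain \<gamma> d'' where \<gamma>: "\<And>i. i < b \<Longrightarrow> \<gamma> i \<in> formsW \<and> linear_form sW (\<gamma> i)"
    and d'': "\<And>w. w - (\<Sum>i<b. sW (\<gamma> i w) (d'' i)) \<in> W0"
    using W.cuts_projection[OF b] by blast
  define P where "P u = u - (\<Sum>i<c. sU (\<alpha> i u) (d i))" for u
  define Q where "Q v = v - (\<Sum>i<a. sV (\<beta> i v) (d' i))" for v
  define R where "R w = w - (\<Sum>i<b. sW (\<gamma> i w) (d'' i))" for w
  have fP: "f (P u) v w = f u v w - (\<Sum>i<c. \<alpha> i u * f (d i) v w)" for u v w
    by (simp add: P_def f_U)
  have fQ: "f u (Q v) w = f u v w - (\<Sum>i<a. \<beta> i v * f u (d' i) w)" for u v w
    by (simp add: Q_def f_V)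
  have fR: "f u v (R w) = f u v w - (\<Sum>i<b. \<gamma> i w * f u v (d'' i))" for u v w
    by (simp add: R_def f_W)
  have linP: "linear_form sU (\<lambda>u. f (P u) v w)" for v w
    unfolding fP U.linear_form_iff using \<alpha>
    by (auto simp: f_U U.linear_form_add U.linear_form_scale sum.distrib distrib_right
        right_diff_distrib sum_distrib_left mult.assoc intro!: sum.cong)
  have linQ: "linear_form sV (\<lambda>v. f u (Q v) w)" for u w
    unfolding fQ V.linear_form_iff using \<beta>
    by (auto simp: f_V V.linear_form_add V.linear_form_scale sum.distrib distrib_right
        right_diff_distrib sum_distrib_left mult.assoc intro!: sum.cong)
  have "sum_of c ?S (\<lambda>u v w. \<Sum>i<c. \<alpha> i u * f (d i) v w)"
    unfolding sum_of_def
  proof (intro exI[of _ "\<lambda>i u v w. \<alpha> i u * f (d i) v w"] conjI allI impI)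
    fix i assume "i < c"
    moreover have "bilinear_form sV sW (\<lambda>v w. f (d i) v w)"
      using linear_V linear_W by (simp add: bilinear_form_def)
    ultimately show "(\<lambda>u v w. \<alpha> i u * f (d i) v w) \<in> ?S"
      using \<alpha> by (intro fixed_coordinate_sliceU) auto
  qed simp
  moreover have "sum_of a ?S (\<lambda>u v w. \<Sum>i<a. \<beta> i v * f (P u) (d' i) w)"
    unfolding sum_of_def
  proof (intro exI[of _ "\<lambda>i u v w. \<beta> i v * f (P u) (d' i) w"] conjI allI impI)
    fix i assume "i < a"
    moreover have "bilinear_form sU sW (\<lambda>u w. f (P u) (d' i) w)"
      using linP linear_W by (simp add: bilinear_form_def)
    ultimately show "(\<lambda>u v w. \<beta> i v * f (P u) (d' i) w) \<in> ?S"
      using \<beta> by (intro fixed_coordinate_sliceV) auto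
  qed simp
  moreover have "sum_of b ?S (\<lambda>u v w. \<Sum>i<b. \<gamma> i w * f (P u) (Q v) (d'' i))"
    unfolding sum_of_def
  proof (intro exI[of _ "\<lambda>i u v w. \<gamma> i w * f (P u) (Q v) (d'' i)"] conjI allI impI)
    fix i assume "i < b"
    moreover have "bilinear_form sU sV (\<lambda>u v. f (P u) (Q v) (d'' i))"
      using linP linQ by (simp add: bilinear_form_def)
    ultimately show "(\<lambda>u v w. \<gamma> i w * f (P u) (Q v) (d'' i)) \<in> ?S"
      using \<gamma> by (intro fixed_coordinate_sliceW) auto
  qed simp
  ultimately have "sum_of (c + a + b) ?S (\<lambda>u v w.
      (\<Sum>i<c. \<alpha> i u * f (d i) v w) + (\<Sum>i<a. \<beta> i v * f (P u) (d' i) w)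
        + (\<Sum>i<b. \<gamma> i w * f (P u) (Q v) (d'' i)))"
    by (intro sum_of_add)
  moreover have "f u v w = (\<Sum>i<c. \<alpha> i u * f (d i) v w) + (\<Sum>i<a. \<beta> i v * f (P u) (d' i) w)
        + (\<Sum>i<b. \<gamma> i w * f (P u) (Q v) (d'' i))" for u v w
  proof -
    have "f (P u) (Q v) (R w) = 0"
      by (rule zero) (simp_all add: P_def Q_def R_def d d' d'')
    then show ?thesis
      using fP[of u v w] fQ[of "P u" v w] fR[of "P u" "Q v" w] by (simp add: algebra_simps)
  qed
  ultimately show ?thesis unfolding sum_of_def by metis
qed

lemma analytic_rank_nonneg: "analytic_rank f \<ge> 0"
proof -
  let ?Z = "{(u, v). \<forall>w. f u v w = 0}"
  have fin: "finite (UNIV :: ('u \<times> 'v) set)"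
    using U.finite_UNIV V.finite_UNIV by (simp add: finite_prod)
  have "(0, 0) \<in> ?Z" by (simp add: f_U)
  then have "card ?Z > 0"
    using fin by (metis card_gt_0_iff empty_iff finite_subset subset_UNIV)
  then have "0 < real (card ?Z)" by linarith
  moreover have "real (card ?Z) \<le> real CARD('u \<times> 'v)"
    using fin by (intro of_nat_mono card_mono) auto
  ultimately have "0 < real (card ?Z) / real CARD('u \<times> 'v)"
      "real (card ?Z) / real CARD('u \<times> 'v) \<le> 1"
    by (simp_all only: divide_pos_pos divide_le_eq_1 order.strict_trans2 simp_thms)
  then have "log (real CARD('k)) (real (card ?Z) / real CARD('u \<times> 'v)) \<le> 0"
    using card_field by (subst log_le_zero_cancel_iff) auto
  then show ?thesis by (simp only: analytic_rank_def neg_0_le_iff_le)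
qed

lemma fixed_coordinate_decomposition:
  "\<exists>m. real m \<le> 5 * analytic_rank f + 1 \<and> sum_of m (fixed_coordinate_slices sU sV sW f) f"
proof -
  obtain j where j: "CARD('u) \<le> 2 ^ j"
    using less_exp less_imp_le by blast
  obtain a b V0 W0 where a: "V.cuts formsV a V0" and b: "W.cuts formsW b W0"
    and le: "real a + real b
        + (1 + 4 / real (2 ^ j)) * (- log (real CARD('k)) (moment (2 ^ j) V0 W0))
       \<le> 5 * analytic_rank f"
    using iterated_potential by blast
  define T where "T = {u. \<forall>v\<in>V0. \<forall>w\<in>W0. f u v w = 0}"
  define B where "B = (\<lambda>(v, w) u. f u v w) ` (V0 \<times> W0)"
  have "T = {u \<in> UNIV. \<forall>\<alpha>\<in>B. \<alpha> u = 0}" unfolding T_def B_def by auto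
  moreover have "B \<subseteq> formsU" "\<And>\<alpha>. \<alpha> \<in> B \<Longrightarrow> linear_form sU \<alpha>"
    using linear_U by (auto simp: B_def formsU_def)
  ultimately obtain c where c: "U.cuts formsU c T"
    using U.cuts_zeros[OF U.cuts_UNIV, of B formsU] by auto
  have "CARD('u) \<le> CARD('k) ^ 2 ^ j"
  proof -
    have "CARD('u) \<le> (2::nat) ^ 2 ^ j" using j less_exp[of "2 ^ j"] by linarith
    also have "\<dots> \<le> CARD('k) ^ 2 ^ j" using card_field by (intro power_mono) auto
    finally show ?thesis .
  qed
  then have cle: "real c \<le> - log (real CARD('k)) (moment (2 ^ j) V0 W0) + 1"
    using codim_vanishing_le[OF V.cuts_subspace[OF a]] c unfolding T_def by blast
  have "0 \<le> - log (real CARD('k)) (moment (2 ^ j) V0 W0)"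
    using moment_le_1 moment_pos V.cuts_subspace[OF a] card_field
    by (simp add: log_le_zero_cancel_iff)
  then have "0 \<le> 4 / real (2 ^ j) * (- log (real CARD('k)) (moment (2 ^ j) V0 W0))"
    by (intro mult_nonneg_nonneg) auto
  with le cle have "real (c + a + b) \<le> 5 * analytic_rank f + 1"
    by (simp only: distrib_right of_nat_add mult_1)
  moreover have "sum_of (c + a + b) (fixed_coordinate_slices sU sV sW f) f"
    by (rule slices_of_vanishing[OF c a b]) (auto simp: T_def)
  ultimately show ?thesis by blast
qed

end

lemma sum_of_mono: "sum_of m S f \<Longrightarrow> S \<subseteq> S' \<Longrightarrow> sum_of m S' f"
  unfolding sum_of_def by (elim exE conjE, rule exI, rule conjI) (auto dest: subsetD)

lemma slices_subset: "slices sU sV sW A B C \<subseteq> slices sU sV sW UNIV UNIV UNIV"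
  unfolding slices_def by (intro Un_mono Collect_mono impI; elim exE conjE; intro exI conjI; simp)

theorem theorem1p2:
  fixes sU :: "'k::{field,finite} \<Rightarrow> 'u::ab_group_add \<Rightarrow> 'u"
    and sV :: "'k \<Rightarrow> 'v::ab_group_add \<Rightarrow> 'v"
    and sW :: "'k \<Rightarrow> 'w::ab_group_add \<Rightarrow> 'w"
    and f :: "'u \<Rightarrow> 'v \<Rightarrow> 'w \<Rightarrow> 'k"
  assumes "finite_dimensional_vector_space sU BU"
    and "finite_dimensional_vector_space sV BV"
    and "finite_dimensional_vector_space sW BW"
    and "trilinear_form sU sV sW f"
  shows "real (slice_rank sU sV sW f)
           \<le> 5 * analytic_rank f + 4 * log (real CARD('k)) (analytic_rank f + 1) + 29 \<and>
         (\<exists>m. real m \<le> 5 * analytic_rank f + 4 * log (real CARD('k)) (analytic_rank f + 1) + 29 \<and>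
              sum_of m (fixed_coordinate_slices sU sV sW f) f)"
proof -
  interpret finite_trilinear sU sV sW f
    using assms by (simp add: finite_trilinear_def finite_trilinear_axioms_def finite_space_of_basis)
  obtain m where m: "real m \<le> 5 * analytic_rank f + 1"
    and dec: "sum_of m (fixed_coordinate_slices sU sV sW f) f"
    using fixed_coordinate_decomposition by blast
  have "0 \<le> log (real CARD('k)) (analytic_rank f + 1)"
    using analytic_rank_nonneg card_field by (intro zero_le_log_cancel_iff[THEN iffD2]) auto
  with m have bound:
    "real m \<le> 5 * analytic_rank f + 4 * log (real CARD('k)) (analytic_rank f + 1) + 29"
    by simp
  have "sum_of m (slices sU sV sW UNIV UNIV UNIV) f"
    by (rule sum_of_mono[OF dec]) (simp add: fixed_coordinate_slices_def slices_subset)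
  then have "slice_rank sU sV sW f \<le> m"
    unfolding slice_rank_def by (rule Least_le)
  then have "real (slice_rank sU sV sW f) \<le> real m" by simp
  then have "real (slice_rank sU sV sW f)
      \<le> 5 * analytic_rank f + 4 * log (real CARD('k)) (analytic_rank f + 1) + 29"
    using bound by linarith
  with bound dec show ?thesis by (intro conjI exI[of _ m])
qed

end
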